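(* Let $m,n,l,T\ge 1$ be integers with $2^l\mid n$, and let $\beta_1,\beta_2\in[0,1)$, $\epsilon>0$, $\alpha>0$, $\eta>0$. Let $F:\mathbb{R}^{m\times n}\to\mathbb{R}$ be differentiable, bounded below by $F_*\in\mathbb{R}$, with gradient $L$-Lipschitz ($L>0$) with respect to the Frobenius norm. Given $W_0\in\mathbb{R}^{m\times n}$, for $t=0,\ldots,T-1$ let $G_t=\nabla F(W_t)$, let $\widetilde G_t$ be the GWT direction built from $G_0,\ldots,G_t$ as defined in the context, and let $W_{t+1}=W_t-\eta\widetilde G_t$. Suppose there are constants $0<s_{\min}\le s_{\max}<\infty$ and $0\le\rho<1$ such that, for every $t\in\{0,\ldots,T-1\}$ and every $j\in\{1,\ldots,l\}$, every entry of $S_{t+1}^{A}$ and of $S_{t+1}^{D,j}$ lies in $[s_{\min},s_{\max}]$, and $$\left\|(S_{t+1}^{A})^{1/2}\odot\big(\widehat M_{t+1}^A-A_t^{(l)}\big)\right\|_F\le\rho\left\|(S_{t+1}^{A})^{1/2}\odot A_t^{(l)}\right\|_F .$$ Define $$\chi=\frac{s_{\max}}{s_{\min}},\qquad \mu=\alpha(1-\rho)s_{\min},\qquad C=\alpha s_{\max}(1+\rho\sqrt{\chi}).$$ Then for every $t\in\{0,\ldots,T-1\}$, $$\langle G_t,\widetilde G_t\rangle_F\ge\mu\|G_t\|_F^2,\qquad \|\widetilde G_t\|_F\le C\|G_t\|_F .$$ If, in addition, the (fixed) learning rate satisfies $0<\eta<2\mu/(LC^2)$, then $$\frac1T\sum_{t=0}^{T-1}\|\nabla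 F(W_t)\|_F^2\le\frac{F(W_0)-F_*}{T\eta\left(\mu-\frac{L\eta C^2}{2}\right)}.$$
   Context: $\langle\cdot,\cdot\rangle_F$ and $\|\cdot\|_F$ are the Frobenius inner product and norm; $\odot$ is the element-wise product; all squares, square roots, divisions and powers of matrices below are element-wise. Haar transform. For even $s$, the Haar matrix $H_s\in\mathbb{R}^{s\times s}$ (which is orthogonal) has, for $i=1,\ldots,s/2$, entries $(H_s)_{2i-1,i}=(H_s)_{2i,i}=(H_s)_{2i-1,s/2+i}=\frac1{\sqrt2}$ and $(H_s)_{2i,s/2+i}=-\frac1{\sqrt2}$, all other entries being zero. For $G\in\mathbb{R}^{m\times n}$ with $2^l\mid n$, set $A^{(0)}=G$ and, for $j=1,\ldots,l$, define $A^{(j)},D^{(j)}\in\mathbb{R}^{m\times n/2^j}$ (approximation and detail coefficients) by $[A^{(j)},D^{(j)}]=A^{(j-1)}H_{n/2^{j-1}}$ (the first $n/2^j$ columns form $A^{(j)}$, the remaining ones $D^{(j)}$). The level-$l$ Haar transform is $\mathcal{H}_l(G)=(A^{(l)},D^{(l)},D^{(l-1)},\ldots,D^{(1)})$; it is a linear bijection with inverse $\mathcal{H}_l^{-1}$. GWT direction. Write $(A_t^{(l)},D_t^{(l)},\ldots,D_t^{(1)})=\mathcal{H}_l(G_t)$. Start from $M_0^A=V_0^A=0\in\mathbb{R}^{m\times n/2^l}$ and for $t\ge0$ set $$M_{t+1}^A=\beta_1M_t^A+(1-\beta_1)A_t^{(l)},\quad V_{t+1}^A=\beta_2V_t^A+(1-\beta_2)(A_t^{(l)})^2,$$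 $$\widehat M_{t+1}^A=\frac{M_{t+1}^A}{1-\beta_1^{t+1}},\quad \widehat V_{t+1}^A=\frac{V_{t+1}^A}{1-\beta_2^{t+1}}.$$ For $1\le j\le l$, the dyadic shape-alignment operator $\mathcal{B}_{j,l}:\mathbb{R}^{m\times n/2^l}\to\mathbb{R}^{m\times n/2^j}$ expands a coarsest-level matrix over the corresponding Haar supports, i.e. it repeats each column $2^{l-j}$ consecutive times: $(\mathcal{B}_{j,l}(V))_{i,k}=V_{i,\lceil k/2^{l-j}\rceil}$. The preconditioners are $$S_{t+1}^A=\frac{1}{\sqrt{\widehat V_{t+1}^A}+\epsilon},\qquad S_{t+1}^{D,j}=\frac{1}{\sqrt{\mathcal{B}_{j,l}(\widehat V_{t+1}^A)}+\epsilon},\quad j=1,\ldots,l.$$ Set $\widetilde A_t^{(l)}=S_{t+1}^A\odot\widehat M_{t+1}^A$ and $\widetilde D_t^{(j)}=S_{t+1}^{D,j}\odot D_t^{(j)}$ for $j=1,\ldots,l$. The GWT direction is $$\widetilde G_t=\alpha\,\mathcal{H}_l^{-1}\big(\widetilde A_t^{(l)},\widetilde D_t^{(l)},\ldots,\widetilde D_t^{(1)}\big).$$ *)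

theory Defs
  imports "HOL-Analysis.Analysis" "Jordan_Normal_Form.Matrix"
begin

no_notation vec_index (infixl "$" 100)

text \<open>Conventions. All matrix indices are 0-based. Matrices whose number of columns depends on the
  Haar level are of type \<^typ>\<open>real mat\<close>; the objective function lives on \<^typ>\<open>real^'n^'m\<close>, whose
  inner product and norm are the Frobenius ones. The two are identified by numberings \<open>r\<close> and \<open>c\<close> of
  the index types of rows and columns.\<close>

definition to_mat :: "(nat \<Rightarrow> 'm::finite) \<Rightarrow> (nat \<Rightarrow> 'n::finite) \<Rightarrow> real^'n^'m \<Rightarrow> real mat" where
  "to_mat r c X = Matrix.mat CARD('m) CARD('n) (\<lambda>(i, k). X $ r i $ c k)"

definition from_mat :: "(nat \<Rightarrow> 'm::finite) \<Rightarrow> (nat \<Rightarrow> 'n::finite) \<Rightarrow> real mat \<Rightarrow> real^'n^'m" where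
  "from_mat r c A =
    (\<chi> a b. A $$ (inv_into {..<CARD('m)} r a, inv_into {..<CARD('n)} c b))"

definition frob_norm :: "real mat \<Rightarrow> real" where
  "frob_norm A = sqrt (\<Sum>i<dim_row A. \<Sum>k<dim_col A. (A $$ (i, k))\<^sup>2)"

definition hadamard :: "real mat \<Rightarrow> real mat \<Rightarrow> real mat" (infixl "\<odot>" 70) where
  "A \<odot> B = Matrix.mat (dim_row A) (dim_col A) (\<lambda>(i, k). A $$ (i, k) * B $$ (i, k))"

definition haar_mat :: "nat \<Rightarrow> real mat" where
  "haar_mat s = Matrix.mat s s (\<lambda>(p, q).
     if \<exists>i < s div 2. (p, q) \<in> {(2*i, i), (2*i+1, i), (2*i, s div 2 + i)} then 1 / sqrt 2
     else if \<exists>i < s div 2. (p, q) = (2*i+1, s div 2 + i) then - 1 / sqrt 2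
     else 0)"

definition left_half :: "real mat \<Rightarrow> real mat" where
  "left_half A = Matrix.mat (dim_row A) (dim_col A div 2) (\<lambda>(i, k). A $$ (i, k))"

definition right_half :: "real mat \<Rightarrow> real mat" where
  "right_half A = Matrix.mat (dim_row A) (dim_col A div 2) (\<lambda>(i, k). A $$ (i, dim_col A div 2 + k))"

primrec approx :: "real mat \<Rightarrow> nat \<Rightarrow> real mat" where
  "approx G 0 = G"
| "approx G (Suc j) = left_half (approx G j * haar_mat (dim_col (approx G j)))"

text \<open>\<open>detail G j\<close> is meaningful for \<open>1 \<le> j\<close> only.\<close>

definition detail :: "real mat \<Rightarrow> nat \<Rightarrow> real mat" where
  "detail G j = right_half (approx G (j - 1) * haar_mat (dim_col (approx G (j - 1))))"

text \<open>The list of detail coefficients is ordered from level \<open>l\<close> down to level 1.\<close>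

definition haar_transform :: "nat \<Rightarrow> real mat \<Rightarrow> real mat \<times> real mat list" where
  "haar_transform l G = (approx G l, map (detail G) (rev [1..<Suc l]))"

text \<open>If \<open>2 ^ l\<close> divides \<open>n\<close>, then \<open>haar_transform l\<close> is injective on \<open>carrier_mat m n\<close>, and its image
  consists of all tuples of coefficient matrices of the right dimensions.\<close>

definition inv_haar_transform :: "nat \<Rightarrow> nat \<Rightarrow> nat \<Rightarrow> real mat \<times> real mat list \<Rightarrow> real mat" where
  "inv_haar_transform m n l = the_inv_into (carrier_mat m n) (haar_transform l)"

primrec ema :: "real \<Rightarrow> (nat \<Rightarrow> real mat) \<Rightarrow> nat \<Rightarrow> real mat" where
  "ema \<beta> X 0 = 0\<^sub>m (dim_row (X 0)) (dim_col (X 0))"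
| "ema \<beta> X (Suc t) = \<beta> \<cdot>\<^sub>m ema \<beta> X t + (1 - \<beta>) \<cdot>\<^sub>m X t"

definition ema_hat :: "real \<Rightarrow> (nat \<Rightarrow> real mat) \<Rightarrow> nat \<Rightarrow> real mat" where
  "ema_hat \<beta> X t = (1 / (1 - \<beta> ^ t)) \<cdot>\<^sub>m ema \<beta> X t"

text \<open>In the following, \<open>G\<close> is the sequence of gradients. In \<open>M_hat\<close>, \<open>V_hat\<close>, \<open>S_A\<close> and \<open>S_D\<close> the
  argument \<open>t\<close> is the subscript, so step \<open>t\<close> of the algorithm uses them at \<open>t + 1\<close>.\<close>

definition M_hat :: "nat \<Rightarrow> real \<Rightarrow> (nat \<Rightarrow> real mat) \<Rightarrow> nat \<Rightarrow> real mat" where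
  "M_hat l \<beta>\<^sub>1 G = ema_hat \<beta>\<^sub>1 (\<lambda>t. approx (G t) l)"

definition V_hat :: "nat \<Rightarrow> real \<Rightarrow> (nat \<Rightarrow> real mat) \<Rightarrow> nat \<Rightarrow> real mat" where
  "V_hat l \<beta>\<^sub>2 G = ema_hat \<beta>\<^sub>2 (\<lambda>t. map_mat (\<lambda>x. x\<^sup>2) (approx (G t) l))"

definition expand :: "nat \<Rightarrow> nat \<Rightarrow> real mat \<Rightarrow> real mat" where
  "expand j l V =
    Matrix.mat (dim_row V) (dim_col V * 2 ^ (l - j)) (\<lambda>(i, k). V $$ (i, k div 2 ^ (l - j)))"

definition S_A :: "nat \<Rightarrow> real \<Rightarrow> real \<Rightarrow> (nat \<Rightarrow> real mat) \<Rightarrow> nat \<Rightarrow> real mat" where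
  "S_A l \<beta>\<^sub>2 \<epsilon> G t = map_mat (\<lambda>v. 1 / (sqrt v + \<epsilon>)) (V_hat l \<beta>\<^sub>2 G t)"

definition S_D :: "nat \<Rightarrow> real \<Rightarrow> real \<Rightarrow> (nat \<Rightarrow> real mat) \<Rightarrow> nat \<Rightarrow> nat \<Rightarrow> real mat" where
  "S_D l \<beta>\<^sub>2 \<epsilon> G t j = map_mat (\<lambda>v. 1 / (sqrt v + \<epsilon>)) (expand j l (V_hat l \<beta>\<^sub>2 G t))"

definition gwt_direction ::
    "nat \<Rightarrow> nat \<Rightarrow> nat \<Rightarrow> real \<Rightarrow> real \<Rightarrow> real \<Rightarrow> real \<Rightarrow> (nat \<Rightarrow> real mat) \<Rightarrow> nat \<Rightarrow> real mat" where
  "gwt_direction m n l \<beta>\<^sub>1 \<beta>\<^sub>2 \<epsilon> \<alpha> G t =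
    \<alpha> \<cdot>\<^sub>m inv_haar_transform m n l
      (S_A l \<beta>\<^sub>2 \<epsilon> G (Suc t) \<odot> M_hat l \<beta>\<^sub>1 G (Suc t),
       map (\<lambda>j. S_D l \<beta>\<^sub>2 \<epsilon> G (Suc t) j \<odot> detail (G t) j) (rev [1..<Suc l]))"

end

theory Submission
  imports Defs
begin

text \<open>The Haar transform is an isometry, so the Frobenius inner product and norm of a matrix split into
  those of its coefficient blocks. On the detail blocks the direction multiplies by weights in
  \<open>[smin, smax]\<close>. On the approximation block, measured in the norm weighted by \<open>S\<close>, the momentum is a
  relative perturbation of size \<open>\<rho>\<close>, which costs a factor \<open>1 - \<rho>\<close> in the inner product and \<open>1 + \<rho>\<close> in
  the norm; the factor \<open>sqrt chi \<ge> 1\<close> in \<open>C\<close> is slack. The descent lemma for \<open>L\<close>-smooth functions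
  then gives a decrease proportional to the squared gradient norm, which telescopes.\<close>

section \<open>Frobenius inner product and norm of matrices of variable size\<close>

text \<open>Summing over index pairs in a single set makes the Frobenius norm an
  \<open>L2_set\<close>, so its Cauchy-Schwarz and triangle inequalities apply to matrices.\<close>

definition frob_inner :: "real mat \<Rightarrow> real mat \<Rightarrow> real" where
  "frob_inner A B = (\<Sum>p\<in>{..<dim_row A} \<times> {..<dim_col A}. A $$ p * B $$ p)"

lemma frob_norm_eq_L2_set:
  "frob_norm A = L2_set (\<lambda>p. A $$ p) ({..<dim_row A} \<times> {..<dim_col A})"
  by (simp add: frob_norm_def L2_set_def sum.cartesian_product)

lemma frob_inner_self: "frob_inner A A = (frob_norm A)\<^sup>2"
  unfolding frob_norm_eq_L2_set L2_set_def frob_inner_def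
  by (simp add: sum_nonneg power2_eq_square)

lemma frob_norm_nonneg: "0 \<le> frob_norm A"
  by (simp add: frob_norm_eq_L2_set L2_set_nonneg)

section \<open>One step of the Haar transform\<close>

text \<open>The Haar matrix mixes only the neighbouring columns \<open>2*p\<close> and
  \<open>2*p + 1\<close>, so sums over columns are grouped into these pairs.\<close>

lemma sum_even_odd:
  fixes f :: "nat \<Rightarrow> 'a::comm_monoid_add"
  shows "(\<Sum>q<2*h. f q) = (\<Sum>p<h. f (2*p) + f (Suc (2*p)))"
  by (induction h) (simp_all add: add.assoc)

lemma haar_mat_entries:
  assumes "p < h" "k < h"
  shows "haar_mat (2*h) $$ (2*p, k) = (if p = k then 1 / sqrt 2 else 0)"
    and "haar_mat (2*h) $$ (Suc (2*p), k) = (if p = k then 1 / sqrt 2 else 0)"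
    and "haar_mat (2*h) $$ (2*p, h + k) = (if p = k then 1 / sqrt 2 else 0)"
    and "haar_mat (2*h) $$ (Suc (2*p), h + k) = (if p = k then - 1 / sqrt 2 else 0)"
  using assms by (auto simp: haar_mat_def)

text \<open>Each column of the Haar matrix has just two nonzero entries, so after pairing rows the
  product sum collapses to the single index \<open>p = k\<close>.\<close>

lemma times_haar_mat_entries:
  assumes "dim_col A = 2 * h" "i < dim_row A" "k < h"
  shows "(A * haar_mat (2*h)) $$ (i, k) = (A $$ (i, 2*k) + A $$ (i, Suc (2*k))) / sqrt 2"
    and "(A * haar_mat (2*h)) $$ (i, h + k) = (A $$ (i, 2*k) - A $$ (i, Suc (2*k))) / sqrt 2"
proof -
  have dims: "haar_mat (2*h) \<in> carrier_mat (2*h) (2*h)"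
    by (simp add: haar_mat_def)
  have prod: "(A * haar_mat (2*h)) $$ (i, q) = (\<Sum>p<h. A $$ (i, 2*p) * haar_mat (2*h) $$ (2*p, q)
      + A $$ (i, Suc (2*p)) * haar_mat (2*h) $$ (Suc (2*p), q))" if "q < 2 * h" for q
  proof -
    have "(A * haar_mat (2*h)) $$ (i, q) = (\<Sum>p<2*h. A $$ (i, p) * haar_mat (2*h) $$ (p, q))"
      using assms that dims by (simp add: scalar_prod_def atLeast0LessThan)
    then show ?thesis
      by (simp only: sum_even_odd)
  qed
  have "(A * haar_mat (2*h)) $$ (i, k)
      = (\<Sum>p<h. if p = k then (A $$ (i, 2*p) + A $$ (i, Suc (2*p))) / sqrt 2 else 0)"
  proof (subst prod)
    show "k < 2 * h"
      using assms(3) by simp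
  qed (intro sum.cong refl, use assms(3) in \<open>simp add: haar_mat_entries add_divide_distrib\<close>)
  then show "(A * haar_mat (2*h)) $$ (i, k) = (A $$ (i, 2*k) + A $$ (i, Suc (2*k))) / sqrt 2"
    using assms by simp
  have "(A * haar_mat (2*h)) $$ (i, h + k)
      = (\<Sum>p<h. if p = k then (A $$ (i, 2*p) - A $$ (i, Suc (2*p))) / sqrt 2 else 0)"
  proof (subst prod)
    show "h + k < 2 * h"
      using assms(3) by simp
  qed (intro sum.cong refl, use assms(3) in \<open>simp add: haar_mat_entries diff_divide_distrib\<close>)
  then show "(A * haar_mat (2*h)) $$ (i, h + k) = (A $$ (i, 2*k) - A $$ (i, Suc (2*k))) / sqrt 2"
    using assms by simp
qed

text \<open>The step from one level to the next, taken out of the recursion so that it can be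
  analysed on an arbitrary matrix with an even number of columns.\<close>

definition haar_low :: "real mat \<Rightarrow> real mat" where
  "haar_low A = left_half (A * haar_mat (dim_col A))"

definition haar_high :: "real mat \<Rightarrow> real mat" where
  "haar_high A = right_half (A * haar_mat (dim_col A))"

text \<open>For blocks of equal size this is \<open>[A, D]\<close> times the transposed Haar matrix,
  which by orthogonality inverts one step; the entrywise form spares a proof of orthogonality as a
  matrix identity.\<close>

definition haar_merge :: "real mat \<Rightarrow> real mat \<Rightarrow> real mat" where
  "haar_merge A D = Matrix.mat (dim_row A) (2 * dim_col A) (\<lambda>(i, q).
     if even q then (A $$ (i, q div 2) + D $$ (i, q div 2)) / sqrt 2
     else (A $$ (i, q div 2) - D $$ (i, q div 2)) / sqrt 2)"

lemma approx_Suc: "approx G (Suc j) = haar_low (approx G j)"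
  by (simp add: haar_low_def)

lemma detail_Suc: "detail G (Suc j) = haar_high (approx G j)"
  by (simp add: haar_high_def detail_def)

lemma haar_low_carrier: "A \<in> carrier_mat m (2*h) \<Longrightarrow> haar_low A \<in> carrier_mat m h"
  by (auto simp: haar_low_def left_half_def haar_mat_def)

lemma haar_high_carrier: "A \<in> carrier_mat m (2*h) \<Longrightarrow> haar_high A \<in> carrier_mat m h"
  by (auto simp: haar_high_def right_half_def haar_mat_def)

lemma haar_merge_carrier: "A \<in> carrier_mat m h \<Longrightarrow> haar_merge A D \<in> carrier_mat m (2*h)"
  by (auto simp: haar_merge_def)

lemma haar_low_entries:
  assumes "A \<in> carrier_mat m (2*h)" "i < m" "k < h"
  shows "haar_low A $$ (i, k) = (A $$ (i, 2*k) + A $$ (i, Suc (2*k))) / sqrt 2"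
  using assms times_haar_mat_entries(1)[of A h i k]
  by (auto simp: haar_low_def left_half_def haar_mat_def)

lemma haar_high_entries:
  assumes "A \<in> carrier_mat m (2*h)" "i < m" "k < h"
  shows "haar_high A $$ (i, k) = (A $$ (i, 2*k) - A $$ (i, Suc (2*k))) / sqrt 2"
  using assms times_haar_mat_entries(2)[of A h i k]
  by (auto simp: haar_high_def right_half_def haar_mat_def)

lemma haar_low_merge:
  assumes "A \<in> carrier_mat m h" "D \<in> carrier_mat m h"
  shows "haar_low (haar_merge A D) = A"
proof (rule eq_matI)
  have M: "haar_merge A D \<in> carrier_mat m (2*h)"
    using assms by (simp add: haar_merge_carrier)
  fix i k assume "i < dim_row A" "k < dim_col A"
  then show "haar_low (haar_merge A D) $$ (i, k) = A $$ (i, k)"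
    using assms by (simp add: haar_low_entries[OF M]) (auto simp: haar_merge_def field_simps)
qed (use assms haar_low_carrier[OF haar_merge_carrier[OF assms(1)]] in auto)

lemma haar_high_merge:
  assumes "A \<in> carrier_mat m h" "D \<in> carrier_mat m h"
  shows "haar_high (haar_merge A D) = D"
proof (rule eq_matI)
  have M: "haar_merge A D \<in> carrier_mat m (2*h)"
    using assms by (simp add: haar_merge_carrier)
  fix i k assume "i < dim_row D" "k < dim_col D"
  then show "haar_high (haar_merge A D) $$ (i, k) = D $$ (i, k)"
    using assms by (simp add: haar_high_entries[OF M]) (auto simp: haar_merge_def field_simps)
qed (use assms haar_high_carrier[OF haar_merge_carrier[OF assms(1)]] in auto)

lemma haar_merge_low_high:
  assumes A: "A \<in> carrier_mat m (2*h)"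
  shows "haar_merge (haar_low A) (haar_high A) = A"
proof (rule eq_matI)
  note low = haar_low_carrier[OF A]
  fix i q assume "i < dim_row A" "q < dim_col A"
  then have i: "i < m" and q: "q div 2 < h" "q < 2 * h"
    using A by auto
  have half: "x / sqrt 2 / sqrt 2 = x / 2" for x :: real
    by simp
  have entry: "haar_merge (haar_low A) (haar_high A) $$ (i, q) =
      (if even q then A $$ (i, 2 * (q div 2)) else A $$ (i, Suc (2 * (q div 2))))"
    using i q low haar_low_entries[OF A i q(1)] haar_high_entries[OF A i q(1)]
    by (auto simp: haar_merge_def add_divide_distrib diff_divide_distrib half)
  show "haar_merge (haar_low A) (haar_high A) $$ (i, q) = A $$ (i, q)"
    unfolding entry by auto
qed (use A haar_merge_carrier[OF haar_low_carrier[OF A]] in auto)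

text \<open>Orthogonality of the Haar matrix, reduced to independent pairs of neighbouring columns.
  The inner product form also covers norms and is needed to compare a gradient with its
  direction.\<close>

lemma frob_inner_low_high:
  assumes A: "A \<in> carrier_mat m (2*h)" and B: "B \<in> carrier_mat m (2*h)"
  shows "frob_inner (haar_low A) (haar_low B) + frob_inner (haar_high A) (haar_high B)
    = frob_inner A B"
proof -
  \<comment> \<open>The map from \<open>(a, b)\<close> to
    \<open>((a + b) / sqrt 2, (a - b) / sqrt 2)\<close> preserves the inner product of the
    plane.\<close>
  have pair: "((a + b) / sqrt 2) * ((c + d) / sqrt 2) + ((a - b) / sqrt 2) * ((c - d) / sqrt 2)
      = a * c + b * d" for a b c d :: real
    by (simp add: field_simps)
  have "frob_inner A B = (\<Sum>i<m. \<Sum>k<2*h. A $$ (i, k) * B $$ (i, k))"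
    using A by (simp add: frob_inner_def sum.cartesian_product)
  also have "\<dots> = (\<Sum>i<m. \<Sum>k<h. haar_low A $$ (i, k) * haar_low B $$ (i, k)
      + haar_high A $$ (i, k) * haar_high B $$ (i, k))"
    unfolding sum_even_odd
    by (intro sum.cong refl)
      (simp only: lessThan_iff haar_low_entries[OF A] haar_low_entries[OF B]
        haar_high_entries[OF A] haar_high_entries[OF B] pair)
  also have "\<dots> = frob_inner (haar_low A) (haar_low B) + frob_inner (haar_high A) (haar_high B)"
    using haar_low_carrier[OF A] haar_high_carrier[OF A]
    by (auto simp: frob_inner_def sum.cartesian_product sum.distrib)
  finally show ?thesis by simp
qed

section \<open>The multilevel transform: dimensions, Parseval identity and inversion\<close>

text \<open>Guarantees that every level below \<open>l\<close> has an even number of columns, so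
  that the one-step lemmas apply to it.\<close>

lemma dvd_halve:
  assumes "2 ^ l dvd (n::nat)" "j < l"
  shows "n div 2 ^ j = 2 * (n div 2 ^ Suc j)"
proof -
  have "2 ^ Suc j dvd n"
    using assms by (meson Suc_leI dvd_trans le_imp_power_dvd)
  then obtain k where "n = 2 ^ Suc j * k" ..
  then show ?thesis by simp
qed

lemma approx_carrier:
  assumes "G \<in> carrier_mat m n" "2 ^ l dvd n" "j \<le> l"
  shows "approx G j \<in> carrier_mat m (n div 2 ^ j)"
  using assms(3)
proof (induction j)
  case 0
  then show ?case using assms by simp
next
  case (Suc j)
  then have "approx G j \<in> carrier_mat m (2 * (n div 2 ^ Suc j))"
    using dvd_halve[OF assms(2), of j] by simp
  then show ?case
    unfolding approx_Suc by (rule haar_low_carrier)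
qed

lemma approx_carrier_double:
  assumes "G \<in> carrier_mat m n" "2 ^ l dvd n" "j < l"
  shows "approx G j \<in> carrier_mat m (2 * (n div 2 ^ Suc j))"
  using approx_carrier[OF assms(1,2), of j] dvd_halve[OF assms(2,3)] assms(3) by simp

lemma detail_carrier:
  assumes "G \<in> carrier_mat m n" "2 ^ l dvd n" "j \<in> {1..l}"
  shows "detail G j \<in> carrier_mat m (n div 2 ^ j)"
proof -
  obtain i where i: "j = Suc i" "i < l"
    using assms(3) by (cases j) auto
  show ?thesis
    unfolding i detail_Suc
    by (rule haar_high_carrier[OF approx_carrier_double[OF assms(1,2) i(2)]])
qed

text \<open>The one-step identity is iterated on the approximation part: each level splits off one
  detail term.\<close>

lemma haar_parseval:
  assumes "X \<in> carrier_mat m n" "Y \<in> carrier_mat m n" "2 ^ l dvd n"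
  shows "frob_inner X Y = frob_inner (approx X l) (approx Y l)
    + (\<Sum>j\<in>{1..l}. frob_inner (detail X j) (detail Y j))"
proof -
  have "frob_inner X Y = frob_inner (approx X k) (approx Y k)
    + (\<Sum>j\<in>{1..k}. frob_inner (detail X j) (detail Y j))" if "k \<le> l" for k
    using that
  proof (induction k)
    case (Suc k)
    then have "k < l" by simp
    from frob_inner_low_high[OF approx_carrier_double[OF assms(1,3) this]
        approx_carrier_double[OF assms(2,3) this]]
    show ?case using Suc
      by (simp add: approx_Suc detail_Suc del: approx.simps(2))
  qed simp
  then show ?thesis by simp
qed

lemma haar_transform_inj:
  assumes "2 ^ l dvd n"
  shows "inj_on (haar_transform l) (carrier_mat m n)"
proof (rule inj_onI)
  fix X Y assume X: "X \<in> carrier_mat m n" and Y: "Y \<in> carrier_mat m n"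
    and eq: "haar_transform l X = haar_transform l Y"
  have "map (detail X) (rev [1..<Suc l]) = map (detail Y) (rev [1..<Suc l])"
    using eq by (simp only: haar_transform_def prod.inject)
  then have D: "detail X j = detail Y j" if "j \<in> {1..l}" for j
    using that by (simp del: upt_Suc)
  have "approx X 0 = approx Y 0"
  \<comment> \<open>The induction runs downwards from \<open>l\<close> to 0: each approximation is
    recovered from the next coarser one and its details by \<open>haar_merge\<close>.\<close>
  proof (rule inc_induct[of 0 l "\<lambda>j. approx X j = approx Y j"])
    show "approx X l = approx Y l"
      using eq by (simp only: haar_transform_def prod.inject)
  next
    fix j assume j: "j < l" and A: "approx X (Suc j) = approx Y (Suc j)"
    have "haar_merge (haar_low (approx X j)) (haar_high (approx X j))
        = haar_merge (haar_low (approx Y j)) (haar_high (approx Y j))"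
      using A D[of "Suc j"] j unfolding approx_Suc detail_Suc by simp
    then show "approx X j = approx Y j"
      unfolding haar_merge_low_high[OF approx_carrier_double[OF X assms j]]
        haar_merge_low_high[OF approx_carrier_double[OF Y assms j]] .
  qed simp
  then show "X = Y" by simp
qed

text \<open>Merging the two coarsest blocks gives an approximation one level finer; the induction
  hypothesis extends it to a full preimage. Hence \<open>A\<close> must stay arbitrary.\<close>

lemma haar_coefficients_surj:
  assumes "2 ^ l dvd n" "A \<in> carrier_mat m (n div 2 ^ l)"
    and "\<And>j. j \<in> {1..l} \<Longrightarrow> D j \<in> carrier_mat m (n div 2 ^ j)"
  shows "\<exists>X\<in>carrier_mat m n. approx X l = A \<and> (\<forall>j\<in>{1..l}. detail X j = D j)"
  using assms
proof (induction l arbitrary: A)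
  case (Suc l)
  have dvd: "2 ^ l dvd n"
    using Suc.prems(1) by (meson dvd_trans le_imp_power_dvd le_SucI order_refl)
  have D: "D (Suc l) \<in> carrier_mat m (n div 2 ^ Suc l)"
    using Suc.prems(3)[of "Suc l"] by simp
  have "haar_merge A (D (Suc l)) \<in> carrier_mat m (n div 2 ^ l)"
    using haar_merge_carrier[OF Suc.prems(2)] dvd_halve[OF Suc.prems(1), of l] by simp
  from Suc.IH[OF dvd this] obtain X where X: "X \<in> carrier_mat m n"
    "approx X l = haar_merge A (D (Suc l))" "\<forall>j\<in>{1..l}. detail X j = D j"
    using Suc.prems(3) by auto
  have "approx X (Suc l) = A" "detail X (Suc l) = D (Suc l)"
    unfolding approx_Suc detail_Suc X(2)
    using haar_low_merge[OF Suc.prems(2) D] haar_high_merge[OF Suc.prems(2) D] by auto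
  then show ?case
    using X by (intro bexI[of _ X]) (auto simp: atLeastAtMostSuc_conv simp del: approx.simps(2))
qed simp

text \<open>Injectivity and surjectivity together replace \<open>the_inv_into\<close> by a
  description through coefficients, the only form in which the inverse is used afterwards.\<close>

lemma inv_haar_transform:
  assumes "2 ^ l dvd n" "A \<in> carrier_mat m (n div 2 ^ l)"
    and "\<And>j. j \<in> {1..l} \<Longrightarrow> D j \<in> carrier_mat m (n div 2 ^ j)"
  defines "X \<equiv> inv_haar_transform m n l (A, map D (rev [1..<Suc l]))"
  shows "X \<in> carrier_mat m n" and "approx X l = A" and "\<And>j. j \<in> {1..l} \<Longrightarrow> detail X j = D j"
proof -
  obtain Y where Y: "Y \<in> carrier_mat m n" "approx Y l = A" "\<forall>j\<in>{1..l}. detail Y j = D j"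
    using haar_coefficients_surj[OF assms(1-3)] by blast
  have "haar_transform l Y = (A, map D (rev [1..<Suc l]))"
    using Y by (auto simp: haar_transform_def)
  then have "X = Y"
    using the_inv_into_f_f[OF haar_transform_inj[OF assms(1)] Y(1)]
    by (simp add: X_def inv_haar_transform_def)
  then show "X \<in> carrier_mat m n" and "approx X l = A" and "\<And>j. j \<in> {1..l} \<Longrightarrow> detail X j = D j"
    using Y by auto
qed

section \<open>Weighted estimates on a single coefficient block\<close>

text \<open>With \<open>N\<close> the norm of \<open>a\<close> weighted by \<open>s\<close>, the sum
  equals \<open>N^2\<close> plus the inner product of \<open>sqrt s * a\<close> and
  \<open>sqrt s * (b - a)\<close>. Cauchy-Schwarz and closeness bound the latter below by
  \<open>- \<rho> * N^2\<close>.\<close>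

lemma weighted_inner_lower:
  fixes a b s :: "'i \<Rightarrow> real"
  assumes s: "\<And>i. i \<in> I \<Longrightarrow> smin \<le> s i" and smin: "0 < smin" and \<rho>: "\<rho> \<le> 1"
    and close: "L2_set (\<lambda>i. sqrt (s i) * (b i - a i)) I \<le> \<rho> * L2_set (\<lambda>i. sqrt (s i) * a i) I"
  shows "(1 - \<rho>) * smin * (L2_set a I)\<^sup>2 \<le> (\<Sum>i\<in>I. a i * (s i * b i))"
proof -
  define N where "N = L2_set (\<lambda>i. sqrt (s i) * a i) I"
  have spos: "0 \<le> s i" if "i \<in> I" for i
    using s[OF that] smin by simp
  have N2: "N\<^sup>2 = (\<Sum>i\<in>I. s i * (a i)\<^sup>2)"
    unfolding N_def L2_set_def using spos
    by (simp add: sum_nonneg power_mult_distrib)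
  have "(\<Sum>i\<in>I. \<bar>sqrt (s i) * a i\<bar> * \<bar>sqrt (s i) * (b i - a i)\<bar>) \<le> N * (\<rho> * N)"
    using L2_set_mult_ineq[of "\<lambda>i. sqrt (s i) * a i" "\<lambda>i. sqrt (s i) * (b i - a i)" I]
      mult_left_mono[OF close, of N]
    by (simp add: N_def)
  moreover have "- (\<Sum>i\<in>I. \<bar>sqrt (s i) * a i\<bar> * \<bar>sqrt (s i) * (b i - a i)\<bar>)
      \<le> (\<Sum>i\<in>I. (sqrt (s i) * a i) * (sqrt (s i) * (b i - a i)))"
    unfolding sum_negf[symmetric] abs_mult[symmetric] by (intro sum_mono) linarith
  moreover have "(\<Sum>i\<in>I. (sqrt (s i) * a i) * (sqrt (s i) * (b i - a i)))
      = (\<Sum>i\<in>I. a i * (s i * b i)) - N\<^sup>2"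
    unfolding N2 sum_subtractf[symmetric]
  proof (intro sum.cong refl)
    fix i assume "i \<in> I"
    have "(sqrt (s i) * a i) * (sqrt (s i) * (b i - a i)) = (sqrt (s i))\<^sup>2 * a i * (b i - a i)"
      by (simp add: power2_eq_square)
    then show "(sqrt (s i) * a i) * (sqrt (s i) * (b i - a i))
        = a i * (s i * b i) - s i * (a i)\<^sup>2"
      using spos[OF \<open>i \<in> I\<close>] by (simp add: algebra_simps power2_eq_square)
  qed
  ultimately have "(1 - \<rho>) * N\<^sup>2 \<le> (\<Sum>i\<in>I. a i * (s i * b i))"
    by (simp add: algebra_simps power2_eq_square)
  \<comment> \<open>Only now is the weighted norm traded for the plain one; doing so after the
    factor \<open>1 - \<rho>\<close> has appeared keeps the ratio of \<open>smax\<close> to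
    \<open>smin\<close> out of the bound.\<close>
  moreover have "smin * (L2_set a I)\<^sup>2 \<le> N\<^sup>2"
    unfolding N2 L2_set_def using s
    by (auto simp: sum_nonneg sum_distrib_left intro!: sum_mono mult_right_mono)
  then have "(1 - \<rho>) * (smin * (L2_set a I)\<^sup>2) \<le> (1 - \<rho>) * N\<^sup>2"
    using \<rho> by (intro mult_left_mono) auto
  ultimately show ?thesis by (simp add: mult.assoc)
qed

lemma L2_set_mult_le:
  fixes u w :: "'i \<Rightarrow> real"
  assumes "\<And>i. i \<in> I \<Longrightarrow> \<bar>w i\<bar> \<le> K" "0 \<le> K"
  shows "L2_set (\<lambda>i. w i * u i) I \<le> K * L2_set u I"
proof -
  have "L2_set (\<lambda>i. w i * u i) I = L2_set (\<lambda>i. \<bar>w i * u i\<bar>) I"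
    by (simp add: L2_set_def)
  also have "\<dots> \<le> L2_set (\<lambda>i. K * \<bar>u i\<bar>) I"
    using assms by (intro L2_set_mono) (auto simp: abs_mult mult_right_mono)
  also have "\<dots> = K * L2_set u I"
    using assms by (simp add: L2_set_right_distrib[symmetric]) (simp add: L2_set_def)
  finally show ?thesis .
qed

text \<open>Split \<open>s * b\<close> into \<open>s * a\<close> and
  \<open>sqrt s * (sqrt s * (b - a))\<close>. In the second term one root is bounded directly and
  the other after closeness is applied; the two factors \<open>sqrt smax\<close> recombine to
  \<open>smax\<close>.\<close>

lemma weighted_norm_upper:
  fixes a b s :: "'i \<Rightarrow> real"
  assumes s: "\<And>i. i \<in> I \<Longrightarrow> 0 \<le> s i \<and> s i \<le> smax" and smax: "0 \<le> smax" and \<rho>: "0 \<le> \<rho>"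
    and close: "L2_set (\<lambda>i. sqrt (s i) * (b i - a i)) I \<le> \<rho> * L2_set (\<lambda>i. sqrt (s i) * a i) I"
  shows "L2_set (\<lambda>i. s i * b i) I \<le> smax * (1 + \<rho>) * L2_set a I"
proof -
  have root: "\<bar>sqrt (s i)\<bar> \<le> sqrt smax" if "i \<in> I" for i
    using s[OF that] by simp
  have "L2_set (\<lambda>i. s i * b i) I
      = L2_set (\<lambda>i. s i * a i + sqrt (s i) * (sqrt (s i) * (b i - a i))) I"
  proof (rule L2_set_cong[OF refl])
    fix i assume "i \<in> I"
    have "sqrt (s i) * (sqrt (s i) * (b i - a i)) = (sqrt (s i))\<^sup>2 * (b i - a i)"
      by (simp add: power2_eq_square)
    then show "s i * b i = s i * a i + sqrt (s i) * (sqrt (s i) * (b i - a i))"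
      using s[OF \<open>i \<in> I\<close>] by (simp add: algebra_simps)
  qed
  also have "\<dots> \<le> L2_set (\<lambda>i. s i * a i) I
      + L2_set (\<lambda>i. sqrt (s i) * (sqrt (s i) * (b i - a i))) I"
    by (rule L2_set_triangle_ineq)
  also have "L2_set (\<lambda>i. s i * a i) I \<le> smax * L2_set a I"
    using s smax by (intro L2_set_mult_le) auto
  also have "L2_set (\<lambda>i. sqrt (s i) * (sqrt (s i) * (b i - a i))) I
      \<le> sqrt smax * (\<rho> * (sqrt smax * L2_set a I))"
  proof -
    have "L2_set (\<lambda>i. sqrt (s i) * (sqrt (s i) * (b i - a i))) I
        \<le> sqrt smax * L2_set (\<lambda>i. sqrt (s i) * (b i - a i)) I"
      using root smax by (intro L2_set_mult_le) auto
    also have "\<dots> \<le> sqrt smax * (\<rho> * L2_set (\<lambda>i. sqrt (s i) * a i) I)"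
      using close smax by (intro mult_left_mono) auto
    also have "\<dots> \<le> sqrt smax * (\<rho> * (sqrt smax * L2_set a I))"
      using root smax \<rho> by (intro mult_left_mono L2_set_mult_le) auto
    finally show ?thesis .
  qed
  also have "smax * L2_set a I + sqrt smax * (\<rho> * (sqrt smax * L2_set a I))
      = smax * L2_set a I + (sqrt smax)\<^sup>2 * \<rho> * L2_set a I"
    by (simp add: power2_eq_square)
  also have "\<dots> = smax * (1 + \<rho>) * L2_set a I"
    using smax by (simp add: algebra_simps)
  finally show ?thesis by simp
qed

lemma hadamard_carrier: "A \<in> carrier_mat m n \<Longrightarrow> A \<odot> B \<in> carrier_mat m n"
  by (simp add: hadamard_def)

text \<open>The two weighted estimates for matrices; in the application \<open>A\<close> is the
  approximation block, \<open>B\<close> the corrected momentum and \<open>S\<close> the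
  preconditioner.\<close>

lemma hadamard_block_bounds:
  assumes A: "A \<in> carrier_mat m n" and B: "B \<in> carrier_mat m n" and S: "S \<in> carrier_mat m n"
    and ran: "elements_mat S \<subseteq> {smin..smax}" and smin: "0 < smin" "smin \<le> smax"
    and \<rho>: "0 \<le> \<rho>" "\<rho> \<le> 1"
    and close: "frob_norm (map_mat sqrt S \<odot> (B - A)) \<le> \<rho> * frob_norm (map_mat sqrt S \<odot> A)"
  shows "(1 - \<rho>) * smin * (frob_norm A)\<^sup>2 \<le> frob_inner A (S \<odot> B)"
    and "frob_norm (S \<odot> B) \<le> smax * (1 + \<rho>) * frob_norm A"
proof -
  let ?I = "{..<m} \<times> {..<n}"
  have s: "smin \<le> S $$ p" "S $$ p \<le> smax" if "p \<in> ?I" for p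
    using ran S that elements_matI[OF S, of "fst p" "snd p"] by auto
  have "L2_set (\<lambda>p. sqrt (S $$ p) * (B $$ p - A $$ p)) ?I
      = frob_norm (map_mat sqrt S \<odot> (B - A))"
    using A B S by (auto simp: frob_norm_eq_L2_set hadamard_def intro!: L2_set_cong)
  moreover have "L2_set (\<lambda>p. sqrt (S $$ p) * A $$ p) ?I = frob_norm (map_mat sqrt S \<odot> A)"
    using A S by (auto simp: frob_norm_eq_L2_set hadamard_def intro!: L2_set_cong)
  ultimately have close': "L2_set (\<lambda>p. sqrt (S $$ p) * (B $$ p - A $$ p)) ?I
      \<le> \<rho> * L2_set (\<lambda>p. sqrt (S $$ p) * A $$ p) ?I"
    using close by simp
  have normA: "frob_norm A = L2_set (\<lambda>p. A $$ p) ?I"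
    using A by (simp add: frob_norm_eq_L2_set)
  have "frob_inner A (S \<odot> B) = (\<Sum>p\<in>?I. A $$ p * (S $$ p * B $$ p))"
    using A S by (auto simp: frob_inner_def hadamard_def intro!: sum.cong)
  then show "(1 - \<rho>) * smin * (frob_norm A)\<^sup>2 \<le> frob_inner A (S \<odot> B)"
    unfolding normA using weighted_inner_lower[OF s(1) smin(1) \<rho>(2) close'] by simp
  have "frob_norm (S \<odot> B) = L2_set (\<lambda>p. S $$ p * B $$ p) ?I"
    using B S by (auto simp: frob_norm_eq_L2_set hadamard_def intro!: L2_set_cong)
  then show "frob_norm (S \<odot> B) \<le> smax * (1 + \<rho>) * frob_norm A"
    unfolding normA using weighted_norm_upper[OF _ _ \<rho>(1) close', of smax] s smin by force
qed

text \<open>Detail blocks carry no momentum: this is the case \<open>B = A\<close> with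
  \<open>\<rho> = 0\<close>.\<close>

lemma hadamard_block_bounds_exact:
  assumes A: "A \<in> carrier_mat m n" and S: "S \<in> carrier_mat m n"
    and ran: "elements_mat S \<subseteq> {smin..smax}" and smin: "0 < smin" "smin \<le> smax"
  shows "smin * (frob_norm A)\<^sup>2 \<le> frob_inner A (S \<odot> A)"
    and "frob_norm (S \<odot> A) \<le> smax * frob_norm A"
proof -
  have "frob_norm (map_mat sqrt S \<odot> (A - A)) = 0"
    using A S by (auto simp: frob_norm_def hadamard_def)
  then have close: "frob_norm (map_mat sqrt S \<odot> (A - A)) \<le> 0 * frob_norm (map_mat sqrt S \<odot> A)"
    by simp
  show "smin * (frob_norm A)\<^sup>2 \<le> frob_inner A (S \<odot> A)"
    and "frob_norm (S \<odot> A) \<le> smax * frob_norm A"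
    using hadamard_block_bounds[OF A A S ran smin _ _ close] by simp_all
qed

section \<open>The GWT direction\<close>

lemma ema_hat_carrier:
  assumes "\<And>t. X t \<in> carrier_mat m n"
  shows "ema_hat \<beta> X t \<in> carrier_mat m n"
proof -
  have "0\<^sub>m (dim_row (X 0)) (dim_col (X 0)) \<in> carrier_mat m n"
    using assms[of 0] by (simp only: carrier_matD zero_carrier_mat)
  \<comment> \<open>A case split suffices in place of an induction: a matrix sum takes its
    dimensions from the second summand, here a multiple of the latest input.\<close>
  then have "ema \<beta> X t \<in> carrier_mat m n"
    using assms by (cases t) auto
  then show ?thesis by (simp add: ema_hat_def)
qed

text \<open>Repeating each of the \<open>n div 2 ^ l\<close> columns \<open>2 ^ (l - j)\<close>
  times gives exactly the width of level \<open>j\<close>; both divisions are exact and the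
  subtraction does not truncate.\<close>

lemma S_D_carrier:
  assumes "V_hat l \<beta>\<^sub>2 G t \<in> carrier_mat m (n div 2 ^ l)" "2 ^ l dvd n" "j \<le> l"
  shows "S_D l \<beta>\<^sub>2 \<epsilon> G t j \<in> carrier_mat m (n div 2 ^ j)"
proof -
  obtain k where "n = 2 ^ l * k"
    using assms(2) ..
  moreover from assms(3) have "(2::nat) ^ l = 2 ^ j * 2 ^ (l - j)"
    by (simp flip: power_add)
  ultimately have "n div 2 ^ l * 2 ^ (l - j) = n div 2 ^ j"
    by (simp add: mult_ac)
  then show ?thesis
    using assms(1) by (simp add: S_D_def expand_def)
qed

lemma frob_inner_smult_right:
  assumes "A \<in> carrier_mat m n" "B \<in> carrier_mat m n"
  shows "frob_inner A (a \<cdot>\<^sub>m B) = a * frob_inner A B"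
  using assms by (auto simp: frob_inner_def sum_distrib_left intro!: sum.cong)

lemma frob_norm_smult: "0 \<le> a \<Longrightarrow> frob_norm (a \<cdot>\<^sub>m A) = a * frob_norm A"
  unfolding frob_norm_eq_L2_set by (auto simp: L2_set_right_distrib intro!: L2_set_cong)

text \<open>The Parseval identity reduces both estimates to the blocks, where the momentum bounds
  serve the approximation and the exact bounds the details.\<close>

lemma gwt_direction_bounds:
  assumes G: "\<And>t. G t \<in> carrier_mat m n" and l: "2 ^ l dvd n" and \<alpha>: "0 < \<alpha>"
    and smin: "0 < smin" "smin \<le> smax" and \<rho>: "0 \<le> \<rho>" "\<rho> < 1"
    and SA: "elements_mat (S_A l \<beta>\<^sub>2 \<epsilon> G (Suc t)) \<subseteq> {smin..smax}"
    and SD: "\<And>j. j \<in> {1..l} \<Longrightarrow> elements_mat (S_D l \<beta>\<^sub>2 \<epsilon> G (Suc t) j) \<subseteq> {smin..smax}"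
    and close: "frob_norm (map_mat sqrt (S_A l \<beta>\<^sub>2 \<epsilon> G (Suc t)) \<odot> (M_hat l \<beta>\<^sub>1 G (Suc t) - approx (G t) l))
      \<le> \<rho> * frob_norm (map_mat sqrt (S_A l \<beta>\<^sub>2 \<epsilon> G (Suc t)) \<odot> approx (G t) l)"
  defines "X \<equiv> gwt_direction m n l \<beta>\<^sub>1 \<beta>\<^sub>2 \<epsilon> \<alpha> G t"
  shows "X \<in> carrier_mat m n"
    and "\<alpha> * (1 - \<rho>) * smin * (frob_norm (G t))\<^sup>2 \<le> frob_inner (G t) X"
    and "frob_norm X \<le> \<alpha> * smax * (1 + \<rho>) * frob_norm (G t)"
proof -
  let ?A = "approx (G t) l" and ?S = "S_A l \<beta>\<^sub>2 \<epsilon> G (Suc t)" and ?M = "M_hat l \<beta>\<^sub>1 G (Suc t)"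
  let ?D = "detail (G t)" and ?SD = "S_D l \<beta>\<^sub>2 \<epsilon> G (Suc t)"
  define Y where "Y = inv_haar_transform m n l (?S \<odot> ?M, map (\<lambda>j. ?SD j \<odot> ?D j) (rev [1..<Suc l]))"
  have X: "X = \<alpha> \<cdot>\<^sub>m Y"
    by (simp add: X_def Y_def gwt_direction_def)
  have approx: "approx (G t) l \<in> carrier_mat m (n div 2 ^ l)" for t
    using approx_carrier[OF G l] by simp
  have M: "?M \<in> carrier_mat m (n div 2 ^ l)"
    unfolding M_hat_def by (intro ema_hat_carrier approx)
  have V: "V_hat l \<beta>\<^sub>2 G (Suc t) \<in> carrier_mat m (n div 2 ^ l)"
    unfolding V_hat_def by (intro ema_hat_carrier) (simp add: approx)
  then have S: "?S \<in> carrier_mat m (n div 2 ^ l)"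
    by (simp add: S_A_def)
  have SDc: "?SD j \<in> carrier_mat m (n div 2 ^ j)" if "j \<in> {1..l}" for j
    using S_D_carrier[OF V l] that by simp
  have Dc: "?D j \<in> carrier_mat m (n div 2 ^ j)" if "j \<in> {1..l}" for j
    using detail_carrier[OF G l that] .
  have Y: "Y \<in> carrier_mat m n" "approx Y l = ?S \<odot> ?M"
    "\<And>j. j \<in> {1..l} \<Longrightarrow> detail Y j = ?SD j \<odot> ?D j"
    unfolding Y_def using inv_haar_transform[OF l hadamard_carrier[OF S] hadamard_carrier[OF SDc]]
    by blast+
  show "X \<in> carrier_mat m n"
    using X Y(1) by simp
  note bA = hadamard_block_bounds[OF approx M S SA smin \<rho>(1) less_imp_le[OF \<rho>(2)] close]
  note bD = hadamard_block_bounds_exact[OF Dc SDc SD smin]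
  have normG: "(frob_norm (G t))\<^sup>2 = (frob_norm ?A)\<^sup>2 + (\<Sum>j\<in>{1..l}. (frob_norm (?D j))\<^sup>2)"
    using haar_parseval[OF G G l, of t t] by (simp add: frob_inner_self)
  \<comment> \<open>The detail blocks satisfy the better constant \<open>smin\<close>; it is
    weakened so that all blocks share one constant and their squared norms add up to that of
    \<open>G t\<close>.\<close>
  have "(1 - \<rho>) * smin * (frob_norm (?D j))\<^sup>2 \<le> frob_inner (?D j) (?SD j \<odot> ?D j)"
    if "j \<in> {1..l}" for j
  proof -
    have "(1 - \<rho>) * smin * (frob_norm (?D j))\<^sup>2 \<le> smin * (frob_norm (?D j))\<^sup>2"
      using \<rho> smin by (intro mult_right_mono) auto
    then show ?thesis
      using bD(1)[OF that that that] by linarith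
  qed
  then have "(1 - \<rho>) * smin * (frob_norm (G t))\<^sup>2 \<le> frob_inner ?A (?S \<odot> ?M)
      + (\<Sum>j\<in>{1..l}. frob_inner (?D j) (?SD j \<odot> ?D j))"
    unfolding normG distrib_left sum_distrib_left by (intro add_mono sum_mono bA(1)) auto
  also have "\<dots> = frob_inner (G t) Y"
    using haar_parseval[OF G Y(1) l, of t] Y(2,3) by simp
  finally have "\<alpha> * ((1 - \<rho>) * smin * (frob_norm (G t))\<^sup>2) \<le> frob_inner (G t) X"
    unfolding X frob_inner_smult_right[OF G Y(1)] using \<alpha> by simp
  then show "\<alpha> * (1 - \<rho>) * smin * (frob_norm (G t))\<^sup>2 \<le> frob_inner (G t) X"
    by (simp add: mult.assoc)
  \<comment> \<open>The common upper constant: attained from the approximation estimate, and at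
    least the \<open>smax\<close> of the detail blocks because \<open>\<rho>\<close> is
    nonnegative.\<close>
  let ?K = "smax * (1 + \<rho>)"
  have K: "0 \<le> ?K" "smax \<le> ?K"
    using smin \<rho> by (auto simp: algebra_simps)
  have "(frob_norm Y)\<^sup>2 = (frob_norm (?S \<odot> ?M))\<^sup>2 + (\<Sum>j\<in>{1..l}. (frob_norm (?SD j \<odot> ?D j))\<^sup>2)"
    using haar_parseval[OF Y(1) Y(1) l] Y(2,3) by (simp add: frob_inner_self)
  also have "\<dots> \<le> (?K * frob_norm ?A)\<^sup>2 + (\<Sum>j\<in>{1..l}. (?K * frob_norm (?D j))\<^sup>2)"
  proof (intro add_mono sum_mono power_mono frob_norm_nonneg bA(2))
    fix j assume j: "j \<in> {1..l}"
    show "frob_norm (?SD j \<odot> ?D j) \<le> ?K * frob_norm (?D j)"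
      using bD(2)[OF j j j] mult_right_mono[OF K(2) frob_norm_nonneg[of "?D j"]] by linarith
  qed
  also have "\<dots> = (?K * frob_norm (G t))\<^sup>2"
    unfolding power_mult_distrib normG distrib_left sum_distrib_left ..
  finally have "frob_norm Y \<le> ?K * frob_norm (G t)"
    by (rule power2_le_imp_le) (rule mult_nonneg_nonneg[OF K(1) frob_norm_nonneg])
  then have "\<alpha> * frob_norm Y \<le> \<alpha> * (?K * frob_norm (G t))"
    using \<alpha> by (intro mult_left_mono) auto
  then show "frob_norm X \<le> \<alpha> * smax * (1 + \<rho>) * frob_norm (G t)"
    using \<alpha> by (simp add: X frob_norm_smult mult.assoc)
qed

section \<open>Identification of the two matrix types\<close>

lemma inner_eq_frob_inner:
  fixes X Y :: "real^'n::finite^'m::finite"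
  assumes r: "bij_betw r {..<CARD('m)} (UNIV :: 'm set)"
    and c: "bij_betw c {..<CARD('n)} (UNIV :: 'n set)"
  shows "inner X Y = frob_inner (to_mat r c X) (to_mat r c Y)"
proof -
  have "inner X Y = (\<Sum>a\<in>UNIV. \<Sum>b\<in>UNIV. X $ a $ b * Y $ a $ b)"
    by (simp add: inner_vec_def)
  also have "\<dots> = (\<Sum>i<CARD('m). \<Sum>b\<in>UNIV. X $ r i $ b * Y $ r i $ b)"
    by (rule sum.reindex_bij_betw[OF r, symmetric])
  also have "\<dots> = (\<Sum>i<CARD('m). \<Sum>k<CARD('n). X $ r i $ c k * Y $ r i $ c k)"
    by (intro sum.cong refl sum.reindex_bij_betw[OF c, symmetric])
  also have "\<dots> = frob_inner (to_mat r c X) (to_mat r c Y)"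
    by (auto simp: frob_inner_def to_mat_def sum.cartesian_product intro!: sum.cong)
  finally show ?thesis .
qed

lemma norm_eq_frob_norm:
  fixes X :: "real^'n::finite^'m::finite"
  assumes r: "bij_betw r {..<CARD('m)} (UNIV :: 'm set)"
    and c: "bij_betw c {..<CARD('n)} (UNIV :: 'n set)"
  shows "norm X = frob_norm (to_mat r c X)"
  by (simp add: norm_eq_sqrt_inner inner_eq_frob_inner[OF assms] frob_inner_self frob_norm_nonneg)

text \<open>Allows bounds proved for the direction as a \<open>real mat\<close> to be transferred to
  the step actually taken in the Euclidean space.\<close>

lemma to_mat_from_mat:
  fixes r :: "nat \<Rightarrow> 'm::finite" and c :: "nat \<Rightarrow> 'n::finite"
  assumes r: "bij_betw r {..<CARD('m)} UNIV" and c: "bij_betw c {..<CARD('n)} UNIV"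
    and A: "A \<in> carrier_mat CARD('m) CARD('n)"
  shows "to_mat r c (from_mat r c A) = A"
  using A bij_betw_inv_into_left[OF r] bij_betw_inv_into_left[OF c]
  by (intro eq_matI) (auto simp: to_mat_def from_mat_def)

section \<open>Descent for functions with Lipschitz gradient\<close>

text \<open>Instead of integrating the gradient along the segment, the quadratic upper model is
  subtracted from \<open>F\<close>; the difference \<open>\<phi>\<close> has nonpositive derivative
  on the unit interval.\<close>

lemma lipschitz_gradient_descent:
  fixes F :: "'a::real_inner \<Rightarrow> real"
  assumes grad: "\<And>x. GDERIV F x :> g x" and lip: "L-lipschitz_on UNIV g"
  shows "F (x + d) \<le> F x + inner (g x) d + L / 2 * (norm d)\<^sup>2"
proof -
  define \<phi> where "\<phi> s = F (x + s *\<^sub>R d) - s * inner (g x) d - L / 2 * (norm d)\<^sup>2 * s\<^sup>2" for s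
  have "\<phi> 1 \<le> \<phi> 0"
  proof (rule DERIV_nonpos_imp_nonincreasing[where f = \<phi> and a = 0 and b = 1])
    fix s :: real assume s: "0 \<le> s" "s \<le> 1"
    have "((\<lambda>s. F (x + s *\<^sub>R d)) has_derivative (\<lambda>h. inner (h *\<^sub>R d) (g (x + s *\<^sub>R d)))) (at s)"
      using grad[of "x + s *\<^sub>R d", unfolded gderiv_def]
      by (rule has_derivative_compose[rotated]) (auto intro!: derivative_eq_intros)
    then have "((\<lambda>s. F (x + s *\<^sub>R d)) has_real_derivative inner d (g (x + s *\<^sub>R d))) (at s)"
      by (simp add: has_field_derivative_def mult.commute[of _ "inner _ _"])
    then have "(\<phi> has_real_derivative
        inner d (g (x + s *\<^sub>R d)) - inner (g x) d - L * (norm d)\<^sup>2 * s) (at s)"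
      unfolding \<phi>_def by (auto intro!: derivative_eq_intros)
    \<comment> \<open>At parameter \<open>s\<close> the gradient has moved by at most
      \<open>L * s * norm d\<close>; after Cauchy-Schwarz this is matched exactly by the derivative
      of the quadratic term.\<close>
    moreover have "inner d (g (x + s *\<^sub>R d)) - inner (g x) d - L * (norm d)\<^sup>2 * s \<le> 0"
    proof -
      have "norm (g (x + s *\<^sub>R d) - g x) \<le> L * (s * norm d)"
        using lipschitz_onD[OF lip, of "x + s *\<^sub>R d" x] s by (simp add: dist_norm)
      then have "inner d (g (x + s *\<^sub>R d) - g x) \<le> norm d * (L * (s * norm d))"
        using norm_cauchy_schwarz[of d "g (x + s *\<^sub>R d) - g x"]
        by (meson mult_left_mono norm_ge_zero order_trans)
      then show ?thesis
        by (simp add: inner_diff_right inner_commute[of "g x"] power2_eq_square algebra_simps)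
    qed
    ultimately show "\<exists>y. (\<phi> has_real_derivative y) (at s) \<and> y \<le> 0"
      by blast
  qed simp
  then show ?thesis by (simp add: \<phi>_def)
qed

text \<open>Inserting both direction bounds into the descent lemma shows that each step lowers
  \<open>F\<close> by at least \<open>\<eta> * (\<mu> - L * \<eta> * C^2 / 2)\<close> times the
  squared gradient norm. These decreases telescope, and their total is at most
  \<open>F (W 0) - Fmin\<close>.\<close>

lemma gradient_method_average_bound:
  fixes F :: "'a::real_inner \<Rightarrow> real"
  assumes grad: "\<And>x. GDERIV F x :> g x" and lip: "L-lipschitz_on UNIV g"
    and lower: "\<And>x. Fmin \<le> F x"
    and step: "\<And>t. t < T \<Longrightarrow> W (Suc t) = W t - \<eta> *\<^sub>R d t"
    and descent: "\<And>t. t < T \<Longrightarrow> \<mu> * (norm (g (W t)))\<^sup>2 \<le> inner (g (W t)) (d t)"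
    and bound: "\<And>t. t < T \<Longrightarrow> norm (d t) \<le> C * norm (g (W t))"
    and T: "1 \<le> T" and \<eta>: "0 < \<eta>" and L: "0 \<le> L" and rate: "0 < \<mu> - L * \<eta> * C\<^sup>2 / 2"
  shows "(1 / real T) * (\<Sum>t<T. (norm (g (W t)))\<^sup>2)
    \<le> (F (W 0) - Fmin) / (real T * \<eta> * (\<mu> - L * \<eta> * C\<^sup>2 / 2))"
proof -
  let ?\<kappa> = "\<mu> - L * \<eta> * C\<^sup>2 / 2"
  have decrease: "\<eta> * ?\<kappa> * (norm (g (W t)))\<^sup>2 \<le> F (W t) - F (W (Suc t))" if t: "t < T" for t
  proof -
    have "F (W (Suc t)) \<le> F (W t) - \<eta> * inner (g (W t)) (d t) + L / 2 * (\<eta>\<^sup>2 * (norm (d t))\<^sup>2)"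
      using lipschitz_gradient_descent[OF grad lip, of "W t" "- \<eta> *\<^sub>R d t"] step[OF t]
      by (simp add: power_mult_distrib)
    moreover have "\<eta> * (\<mu> * (norm (g (W t)))\<^sup>2) \<le> \<eta> * inner (g (W t)) (d t)"
      using descent[OF t] \<eta> by simp
    moreover have "L / 2 * (\<eta>\<^sup>2 * (norm (d t))\<^sup>2) \<le> L / 2 * (\<eta>\<^sup>2 * (C * norm (g (W t)))\<^sup>2)"
      using bound[OF t] L by (intro mult_left_mono power_mono) auto
    ultimately show ?thesis
      by (simp add: algebra_simps power2_eq_square)
  qed
  have "\<eta> * ?\<kappa> * (\<Sum>t<T. (norm (g (W t)))\<^sup>2) \<le> (\<Sum>t<T. F (W t) - F (W (Suc t)))"
    unfolding sum_distrib_left by (intro sum_mono decrease) simp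
  also have "\<dots> = F (W 0) - F (W T)"
    by (rule sum_lessThan_telescope')
  also have "\<dots> \<le> F (W 0) - Fmin"
    using lower by simp
  finally have "(\<Sum>t<T. (norm (g (W t)))\<^sup>2) \<le> (F (W 0) - Fmin) / (\<eta> * ?\<kappa>)"
    using \<eta> rate by (simp add: pos_le_divide_eq mult.commute)
  then have "(1 / real T) * (\<Sum>t<T. (norm (g (W t)))\<^sup>2)
      \<le> (1 / real T) * ((F (W 0) - Fmin) / (\<eta> * ?\<kappa>))"
    by (intro mult_left_mono) auto
  then show ?thesis by (simp add: mult.assoc)
qed

section \<open>Direction bounds and convergence of the GWT iteration\<close>

theorem theorem3p4:
  fixes F :: "real^'n^'m \<Rightarrow> real"
    and gradF :: "real^'n^'m \<Rightarrow> real^'n^'m"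
    and W G Gt :: "nat \<Rightarrow> real^'n^'m"
    and r :: "nat \<Rightarrow> 'm::finite" and c :: "nat \<Rightarrow> 'n::finite"
    and l T :: nat
    and \<beta>\<^sub>1 \<beta>\<^sub>2 \<epsilon> \<alpha> \<eta> L Fmin smin smax \<rho> chi \<mu> C :: real
    and Gm :: "nat \<Rightarrow> real mat"
  assumes "bij_betw r {..<CARD('m)} UNIV" and "bij_betw c {..<CARD('n)} UNIV"
    and "l \<ge> 1" and "T \<ge> 1" and "2 ^ l dvd CARD('n)"
    and "0 \<le> \<beta>\<^sub>1" and "\<beta>\<^sub>1 < 1" and "0 \<le> \<beta>\<^sub>2" and "\<beta>\<^sub>2 < 1"
    and "\<epsilon> > 0" and "\<alpha> > 0" and "\<eta> > 0" and "L > 0"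
    and "\<And>X. GDERIV F X :> gradF X"
    and "\<And>X. Fmin \<le> F X"
    and "L-lipschitz_on UNIV gradF"
    and "G = (\<lambda>t. gradF (W t))"
    and "Gm = (\<lambda>t. to_mat r c (G t))"
    and "Gt = (\<lambda>t. from_mat r c (gwt_direction CARD('m) CARD('n) l \<beta>\<^sub>1 \<beta>\<^sub>2 \<epsilon> \<alpha> Gm t))"
    and "\<And>t. t < T \<Longrightarrow> W (Suc t) = W t - \<eta> *\<^sub>R Gt t"
    and "0 < smin" and "smin \<le> smax" and "0 \<le> \<rho>" and "\<rho> < 1"
    and "\<And>t. t < T \<Longrightarrow> elements_mat (S_A l \<beta>\<^sub>2 \<epsilon> Gm (Suc t)) \<subseteq> {smin..smax}"
    and "\<And>t j. t < T \<Longrightarrow> j \<in> {1..l} \<Longrightarrow> elements_mat (S_D l \<beta>\<^sub>2 \<epsilon> Gm (Suc t) j) \<subseteq> {smin..smax}"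
    and "\<And>t. t < T \<Longrightarrow>
           frob_norm (map_mat sqrt (S_A l \<beta>\<^sub>2 \<epsilon> Gm (Suc t)) \<odot> (M_hat l \<beta>\<^sub>1 Gm (Suc t) - approx (Gm t) l))
             \<le> \<rho> * frob_norm (map_mat sqrt (S_A l \<beta>\<^sub>2 \<epsilon> Gm (Suc t)) \<odot> approx (Gm t) l)"
    and "chi = smax / smin"
    and "\<mu> = \<alpha> * (1 - \<rho>) * smin"
    and "C = \<alpha> * smax * (1 + \<rho> * sqrt chi)"
  shows "(\<forall>t<T. \<mu> * (norm (G t))\<^sup>2 \<le> inner (G t) (Gt t) \<and> norm (Gt t) \<le> C * norm (G t))
    \<and> (\<eta> < 2 * \<mu> / (L * C\<^sup>2) \<longrightarrow>
        (1 / real T) * (\<Sum>t<T. (norm (gradF (W t)))\<^sup>2)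
          \<le> (F (W 0) - Fmin) / (real T * \<eta> * (\<mu> - L * \<eta> * C\<^sup>2 / 2)))"
proof -
  note r = assms(1) and c = assms(2)
  have Gm: "Gm t \<in> carrier_mat CARD('m) CARD('n)" for t
    by (simp add: assms(18) to_mat_def)
  have chi: "1 \<le> sqrt chi"
    using assms(21,22,28) by simp
  \<comment> \<open>Since \<open>sqrt chi\<close> is at least 1, \<open>C\<close> dominates the
    constant from the block estimates. Its positivity serves to clear the denominator in the
    learning rate condition.\<close>
  have C: "\<alpha> * smax * (1 + \<rho>) \<le> C" "0 < C"
  proof -
    show "\<alpha> * smax * (1 + \<rho>) \<le> C"
      unfolding assms(30) using assms(11,21,22,23) chi mult_left_mono[OF chi, of \<rho>]
      by (intro mult_left_mono) auto
    moreover have "0 < \<alpha> * smax * (1 + \<rho>)"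
      using assms(11,21,22,23) by simp
    ultimately show "0 < C" by simp
  qed
  have direction: "\<mu> * (norm (G t))\<^sup>2 \<le> inner (G t) (Gt t)" "norm (Gt t) \<le> C * norm (G t)"
    if t: "t < T" for t
  proof -
    note b = gwt_direction_bounds[OF Gm assms(5,11,21-24) assms(25-27)[OF t]]
    have Gt: "to_mat r c (Gt t) = gwt_direction CARD('m) CARD('n) l \<beta>\<^sub>1 \<beta>\<^sub>2 \<epsilon> \<alpha> Gm t"
      unfolding assms(19) by (rule to_mat_from_mat[OF r c b(1)])
    have G: "to_mat r c (G t) = Gm t"
      by (simp add: assms(18))
    show "\<mu> * (norm (G t))\<^sup>2 \<le> inner (G t) (Gt t)"
      using b(2) by (simp add: inner_eq_frob_inner[OF r c] norm_eq_frob_norm[OF r c] Gt G assms(29))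
    have "norm (Gt t) \<le> \<alpha> * smax * (1 + \<rho>) * norm (G t)"
      using b(3) by (simp add: norm_eq_frob_norm[OF r c] Gt G)
    also have "\<dots> \<le> C * norm (G t)"
      using C by (intro mult_right_mono) auto
    finally show "norm (Gt t) \<le> C * norm (G t)" .
  qed
  have "(1 / real T) * (\<Sum>t<T. (norm (gradF (W t)))\<^sup>2)
      \<le> (F (W 0) - Fmin) / (real T * \<eta> * (\<mu> - L * \<eta> * C\<^sup>2 / 2))" if "\<eta> < 2 * \<mu> / (L * C\<^sup>2)"
  proof (rule gradient_method_average_bound[where F = F and g = gradF and d = Gt, OF assms(14,16,15,20) _ _ assms(4,12)])
    \<comment> \<open>This is the learning rate condition multiplied by the positive number
      \<open>L * C^2\<close> and halved.\<close>
    show "0 < \<mu> - L * \<eta> * C\<^sup>2 / 2"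
      using that C(2) assms(13) by (simp add: pos_less_divide_eq algebra_simps)
  qed (use direction assms(13,17) in auto)
  then show ?thesis
    using direction by blast
qed

end
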